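(* Let $\mathbf{y}\in\mathbb{R}^T$, let $\mathbf{F},\bar{\mathbf{F}}\in\mathbb{R}^{T\times S}$ and $\boldsymbol{\psi}\in\mathbb{R}^S$, and let the weights $\hat{\mathbf{w}}^{\mathcal{X}}_Z$ be the solutions of the optimization problems defined in the context. $\lambda_{\min}(\cdot)$ and $\lambda_{\max}(\cdot)$ denote the smallest and largest eigenvalues of a symmetric matrix. Then: (1) If $\lambda_{\min}(T^{-1}\mathbf{F}^\top\mathbf{F})>0$, then $\hat{\mathbf{w}}^{\mathcal{X}}_Z$ is unique for every $\mathcal{X}\in\{\mathcal{A},\mathcal{B},\mathcal{C},\mathcal{D}\}$ and $Z\in\{\mathrm{reg},\mathrm{ma}\}$. (2) If $\lambda_{\min}(T^{-1}\tilde{\mathbf{F}}^\top\tilde{\mathbf{F}})>0$, where $\tilde{\mathbf{F}}=(\mathbf{1},\mathbf{F})$, then $\hat{\mathbf{w}}^{\mathcal{A}'}_{\mathrm{reg}}$ is unique. (3) If $\lambda_{\min}(T^{-1}\bar{\mathbf{F}}^\top\bar{\mathbf{F}})>0$, then $\hat{\mathbf{w}}^{\mathcal{X}}_{\mathrm{cv}}$ is unique for every $\mathcal{X}\in\{\mathcal{A},\mathcal{B},\mathcal{C},\mathcal{D}\}$. (4) If $\|(\mathbf{F}^\top\mathbf{F}-\nu\mathbf{I})^{-1}\mathbf{F}^\top\mathbf{y}\|>1$ for all $\nu\in(\lambda_{\min}(\mathbf{F}^\top\mathbf{F}),\lambda_{\max}(\mathbf{F}^\top\mathbf{F}))$, then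 $\hat{\mathbf{w}}^{\mathcal{E}}_{\mathrm{reg}}$ is unique. (5) If $\|(\mathbf{F}^\top\mathbf{F}-\nu\mathbf{I})^{-1}\boldsymbol{\psi}\|>1$ for all $\nu\in(\lambda_{\min}(\mathbf{F}^\top\mathbf{F}),\lambda_{\max}(\mathbf{F}^\top\mathbf{F}))$, then $\hat{\mathbf{w}}^{\mathcal{E}}_{\mathrm{ma}}$ is unique. (6) If $\|(\bar{\mathbf{F}}^\top\bar{\mathbf{F}}-\nu\mathbf{I})^{-1}\bar{\mathbf{F}}^\top\mathbf{y}\|>1$ for all $\nu\in(\lambda_{\min}(\bar{\mathbf{F}}^\top\bar{\mathbf{F}}),\lambda_{\max}(\bar{\mathbf{F}}^\top\bar{\mathbf{F}}))$, then $\hat{\mathbf{w}}^{\mathcal{E}}_{\mathrm{cv}}$ is unique. (7) If the smallest root of the characteristic polynomial of $(\mathbf{y}\otimes\mathbf{1}^\top-\mathbf{F})^\top(\mathbf{y}\otimes\mathbf{1}^\top-\mathbf{F})$ has multiplicity $1$ and the first element of $\hat{\mathbf{w}}^{\mathcal{E}}_{\mathrm{eig}}$ is (required to be) positive, then $\hat{\mathbf{w}}^{\mathcal{E}}_{\mathrm{eig}}$ is unique. In (4)–(6) the conditions are imposed at those $\nu$ in the interval for which the matrix to be inverted is nonsingular.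
   Context: Data and forecasts. $\mathbf{y}=(y_1,\ldots,y_T)^\top$ is the observed vector; $\mathbf{f}_t\in\mathbb{R}^S$ is the vector of $S$ candidate forecasts at time $t$; $\mathbf{F}=(\mathbf{f}_1,\ldots,\mathbf{f}_T)^\top$ has columns $\mathbf{f}_{(1)},\ldots,\mathbf{f}_{(S)}$; $\mathbf{f}_t^{[-t]}\in\mathbb{R}^S$ is the vector of candidate forecasts for time $t$ computed without the $t$-th observation, and $\bar{\mathbf{F}}=(\mathbf{f}_1^{[-1]},\ldots,\mathbf{f}_T^{[-T]})^\top$. All these are given (uniqueness is for the realized data). $\mathbf{1}$ is a vector of ones of the appropriate dimension; $\otimes$ is the Kronecker product, so $\mathbf{y}\otimes\mathbf{1}^\top=\mathbf{y}\mathbf{1}^\top$ is $T\times S$; $\|\cdot\|$ is the Euclidean norm. Weight spaces. $\mathbb{W}^{\mathcal{A}}=\mathbb{R}^S$; $\mathbb{W}^{\mathcal{B}}=\{\mathbf{w}:\mathbf{w}^\top\mathbf{1}=1\}$; $\mathbb{W}^{\mathcal{C}}=[0,1]^S$; $\mathbb{W}^{\mathcal{D}}=\{\mathbf{w}\in[0,1]^S:\mathbf{1}^\top\mathbf{w}=1\}$; $\mathbb{W}^{\mathcal{E}}=\{\mathbf{w}\in\mathbb{R}^S:\mathbf{w}^\top\mathbf{w}=1\}$. Weights. For $\mathcal{X}\in\{\mathcal{A},\mathcal{B},\mathcal{C},\mathcal{D},\mathcal{E}\}$: - $\hat{\mathbf{w}}^{\mathcal{X}}_{\mathrm{reg}}$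 is a minimizer of $\|\mathbf{y}-\mathbf{F}\mathbf{w}\|^2$ over $\mathbf{w}\in\mathbb{W}^{\mathcal{X}}$. - $\hat{\mathbf{w}}^{\mathcal{A}'}_{\mathrm{reg}}$ is the $\mathbf{w}$-part of a minimizer $(\delta_0,\mathbf{w})\in\mathbb{R}\times\mathbb{R}^S$ of $\|\mathbf{y}-\delta_0\mathbf{1}-\mathbf{F}\mathbf{w}\|^2$. - $\hat{\mathbf{w}}^{\mathcal{X}}_{\mathrm{ma}}$ is a minimizer over $\mathbb{W}^{\mathcal{X}}$ of the generalized Mallows criterion $\mathbf{w}^\top\mathbf{F}^\top\mathbf{F}\mathbf{w}+2\mathbf{w}^\top\boldsymbol{\psi}+\mathbf{y}^\top\mathbf{y}$, where $\boldsymbol{\psi}=\hat{\sigma}^2\mathbf{k}-\mathbf{F}^\top\mathbf{y}$ (Mallows criterion) or $\boldsymbol{\psi}=\hat{\sigma}^2\mathbf{k}-\boldsymbol{\phi}-\mathbf{F}^\top\mathbf{y}$ (Kullback–Leibler criterion). Here $\mathbf{f}_{(s)}=\mathbf{P}_s\mathbf{y}$ with $\mathbf{P}_s$ the projection matrix of the $s$-th candidate linear model, $\mathbf{k}=(\mathrm{tr}(\mathbf{P}_1),\ldots,\mathrm{tr}(\mathbf{P}_S))^\top$, $\hat{\sigma}^2$ is an estimator of the error variance, and $\boldsymbol{\phi}=(\mathbf{f}_{(1)},\ldots,\mathbf{f}_{(S)})^\top\partial\hat{\sigma}^2/\partial\mathbf{y}$; none of these depends on $\mathbf{w}$. - $\hat{\mathbf{w}}^{\mathcal{X}}_{\mathrm{cv}}$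 is a minimizer of $\|\mathbf{y}-\bar{\mathbf{F}}\mathbf{w}\|^2$ over $\mathbb{W}^{\mathcal{X}}$. - $\hat{\mathbf{w}}^{\mathcal{E}}_{\mathrm{eig}}$ is a minimizer of $T^{-1}\|(\mathbf{y}\otimes\mathbf{1}^\top-\mathbf{F})\mathbf{w}\|^2$ over $\mathbb{W}^{\mathcal{E}}$, i.e. a unit-norm eigenvector belonging to the smallest eigenvalue of $T^{-1}(\mathbf{y}\otimes\mathbf{1}^\top-\mathbf{F})^\top(\mathbf{y}\otimes\mathbf{1}^\top-\mathbf{F})$. "Unique" means that the corresponding optimization problem has exactly one solution (in (7), exactly one solution with positive first element).
   Formalization: In (4)–(6) the formal theorem excludes the case where λ_min = λ_max and the vector (F^T y, ψ, resp. F̄^T y) is zero, in which uniqueness always fails; in (7) "first element positive" is read as: some solution has a positive first element. *)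

theory Defs
  imports "HOL-Analysis.Analysis" "HOL-Computational_Algebra.Polynomial"
begin

text \<open>
  A \<open>T \<times> S\<close> matrix has type \<open>real^'s^'t\<close> with \<open>CARD('t) = T\<close> and \<open>CARD('s) = S\<close>. The constant
  \<open>1\<close> at a vector type is the vector of ones; \<open>mat 1\<close> is the identity matrix.
\<close>

section \<open>Eigenvalues and characteristic polynomial\<close>

definition eigenvalue :: "real^'n^'n \<Rightarrow> real \<Rightarrow> bool" where
  "eigenvalue A l \<longleftrightarrow> (\<exists>v. v \<noteq> 0 \<and> A *v v = l *\<^sub>R v)"

text \<open>Meaningful for symmetric matrices, whose set of real eigenvalues is finite and nonempty.\<close>

definition lambda_min :: "real^'n^'n \<Rightarrow> real" where
  "lambda_min A = Min {l. eigenvalue A l}"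

definition lambda_max :: "real^'n^'n \<Rightarrow> real" where
  "lambda_max A = Max {l. eigenvalue A l}"

text \<open>\<open>det (X I - A)\<close>, computed over the ring of real polynomials.\<close>

definition charpoly :: "real^'n^'n \<Rightarrow> real poly" where
  "charpoly A = det (mat [:0, 1:] - (\<chi> i j. [:A $ i $ j:]))"

lemma poly_charpoly: "poly (charpoly A) x = det (x *\<^sub>R mat 1 - A)"
  unfolding charpoly_def det_def
  by (auto simp: poly_sum poly_prod mat_def intro!: sum.cong prod.cong)

lemma eigenvalue_iff_root: "eigenvalue A l \<longleftrightarrow> poly (charpoly A) l = 0"
proof -
  have *: "A *v v = l *\<^sub>R v \<longleftrightarrow> (l *\<^sub>R mat 1 - A) *v v = 0" for v
    by (auto simp: matrix_vector_mult_diff_rdistrib scaleR_matrix_vector_assoc[symmetric])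
  have "poly (charpoly A) l = 0 \<longleftrightarrow> \<not> invertible (l *\<^sub>R mat 1 - A)"
    by (simp add: poly_charpoly invertible_det_nz)
  then show ?thesis
    unfolding eigenvalue_def * invertible_left_inverse matrix_left_invertible_ker by blast
qed

section \<open>Weight spaces\<close>

definition W_A :: "(real^'s) set" where
  "W_A = UNIV"

definition W_B :: "(real^'s) set" where
  "W_B = {w. w \<bullet> 1 = 1}"

definition W_C :: "(real^'s) set" where
  "W_C = {w. \<forall>s. w $ s \<in> {0..1}}"

definition W_D :: "(real^'s) set" where
  "W_D = {w. (\<forall>s. w $ s \<in> {0..1}) \<and> 1 \<bullet> w = 1}"

definition W_E :: "(real^'s) set" where
  "W_E = {w. w \<bullet> w = 1}"

section \<open>Combination weights\<close>

definition is_w_reg :: "(real^'s) set \<Rightarrow> real^'t \<Rightarrow> real^'s^'t \<Rightarrow> real^'s \<Rightarrow> bool" where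
  "is_w_reg W y F w \<longleftrightarrow> is_arg_min (\<lambda>w. (norm (y - F *v w))\<^sup>2) (\<lambda>w. w \<in> W) w"

text \<open>Regression with an unconstrained intercept; the solution is the pair of intercept and weights.\<close>

definition is_w_reg_intercept :: "real^'t \<Rightarrow> real^'s^'t \<Rightarrow> real \<times> (real^'s) \<Rightarrow> bool" where
  "is_w_reg_intercept y F p \<longleftrightarrow>
     is_arg_min (\<lambda>(\<delta>, w). (norm (y - \<delta> *\<^sub>R 1 - F *v w))\<^sup>2) (\<lambda>_. True) p"

text \<open>
  Generalized Mallows criterion. With \<open>\<psi> = \<sigma>\<^sup>2 k - F\<^sup>T y\<close> it is the Mallows criterion and with
  \<open>\<psi> = \<sigma>\<^sup>2 k - \<phi> - F\<^sup>T y\<close> the Kullback-Leibler criterion (\<open>\<sigma>\<^sup>2\<close> the variance estimate, \<open>k\<close> the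
  traces of the candidate projection matrices, \<open>\<phi>\<close> the derivative correction); the weights depend
  on these only through the fixed vector \<open>\<psi>\<close>.
\<close>

definition mallows_crit :: "real^'t \<Rightarrow> real^'s^'t \<Rightarrow> real^'s \<Rightarrow> real^'s \<Rightarrow> real" where
  "mallows_crit y F \<psi> w = w \<bullet> ((transpose F ** F) *v w) + 2 * (w \<bullet> \<psi>) + y \<bullet> y"

definition is_w_ma :: "(real^'s) set \<Rightarrow> real^'t \<Rightarrow> real^'s^'t \<Rightarrow> real^'s \<Rightarrow> real^'s \<Rightarrow> bool" where
  "is_w_ma W y F \<psi> w \<longleftrightarrow> is_arg_min (mallows_crit y F \<psi>) (\<lambda>w. w \<in> W) w"

text \<open>\<open>Fbar\<close> holds the leave-one-out forecasts.\<close>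

definition is_w_cv :: "(real^'s) set \<Rightarrow> real^'t \<Rightarrow> real^'s^'t \<Rightarrow> real^'s \<Rightarrow> bool" where
  "is_w_cv W y Fbar w \<longleftrightarrow> is_arg_min (\<lambda>w. (norm (y - Fbar *v w))\<^sup>2) (\<lambda>w. w \<in> W) w"

text \<open>The matrix of individual forecast errors; the first summand is \<open>y \<otimes> 1\<^sup>T = y 1\<^sup>T\<close>.\<close>

definition err_mat :: "real^'t \<Rightarrow> real^'s^'t \<Rightarrow> real^'s^'t" where
  "err_mat y F = (columnvector y :: real^1^'t) ** rowvector 1 - F"

definition is_w_eig :: "real^'t \<Rightarrow> real^'s^'t \<Rightarrow> real^'s \<Rightarrow> bool" where
  "is_w_eig y F w \<longleftrightarrow>
     is_arg_min (\<lambda>w. inverse (real CARD('t)) * (norm (err_mat y F *v w))\<^sup>2) (\<lambda>w. w \<in> W_E) w"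

section \<open>Matrices and conditions\<close>

definition scaled_gram :: "real^'n^'t \<Rightarrow> real^'n^'n" where
  "scaled_gram M = inverse (real CARD('t)) *\<^sub>R (transpose M ** M)"

text \<open>\<open>(1, F)\<close>: the index \<open>None\<close> stands for the added column of ones.\<close>

definition add_intercept :: "real^'s^'t \<Rightarrow> real^('s option)^'t" where
  "add_intercept F = (\<chi> t j. case j of None \<Rightarrow> 1 | Some s \<Rightarrow> F $ t $ s)"

text \<open>
  \<open>\<parallel>(A - \<nu> I)\<^sup>-\<^sup>1 b\<parallel> > 1\<close> for all \<open>\<nu>\<close> strictly between the extreme eigenvalues of \<open>A\<close> at which
  the inverse exists.
\<close>

definition resolvent_cond :: "real^'n^'n \<Rightarrow> real^'n \<Rightarrow> bool" where
  "resolvent_cond A b \<longleftrightarrow>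
     (\<forall>\<nu> \<in> {lambda_min A <..< lambda_max A}.
        invertible (A - \<nu> *\<^sub>R mat 1) \<longrightarrow> norm (matrix_inv (A - \<nu> *\<^sub>R mat 1) *v b) > 1)"

text \<open>
  If \<open>A\<close> has a single eigenvalue, the interval is empty and \<open>resolvent_cond A b\<close> holds vacuously.
  When moreover \<open>b = 0\<close>, the quadratic \<open>w\<^sup>T A w - 2 w\<^sup>T b\<close> is constant on the unit sphere, so every
  unit vector minimizes it. This is the only case ruled out here.
\<close>

definition nondegenerate :: "real^'n^'n \<Rightarrow> real^'n \<Rightarrow> bool" where
  "nondegenerate A b \<longleftrightarrow> lambda_min A < lambda_max A \<or> b \<noteq> 0"

text \<open>The first element of a vector, the index type being linearly ordered.\<close>

definition first_elem :: "real^('s::{finite,linorder}) \<Rightarrow> real" where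
  "first_elem w = w $ Min UNIV"

end

theory Submission
  imports Defs
begin

text \<open>
  All criteria are quadratic in the weights, and there are three reasons for uniqueness.

  On a closed convex set (the spaces \<open>W_A\<close> to \<open>W_D\<close>, and the regression with intercept), completing
  the square turns the criterion into the distance from a point to the image of the set under an
  injective linear map. The nearest point of a closed convex set is unique, and injectivity, which
  is what a positive smallest eigenvalue of the Gram matrix says, makes its preimage unique.

  On the unit sphere, let \<open>w\<close> minimize \<open>w \<bullet> A w - 2 (w \<bullet> b)\<close> with \<open>A\<close> symmetric. There is a
  multiplier \<open>\<nu>\<close> with \<open>(A - \<nu> I) w = b\<close> and \<open>A - \<nu> I\<close> positive semidefinite
  (\<open>sphere_minimizer_multiplier\<close>). For every unit vector \<open>w'\<close>, the excess of its value over the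
  minimum is \<open>(w' - w) \<bullet> (A - \<nu> I) (w' - w)\<close>. Hence a second minimizer \<open>w'\<close> differs from \<open>w\<close> by a
  null vector of \<open>A - \<nu> I\<close>, so \<open>\<nu>\<close> is the smallest eigenvalue, and the midpoint of \<open>w\<close> and \<open>w'\<close> solves
  \<open>(A - \<nu> I) x = b\<close> with norm less than 1. As \<open>\<mu>\<close> decreases to \<open>\<nu>\<close>, the vectors \<open>(A - \<mu> I)\<^sup>-\<^sup>1 b\<close>
  converge to the solution of least norm, so they are eventually shorter than 1
  (\<open>resolvent_small_right_of_eigenvalue\<close>), which the resolvent condition forbids when the spectrum is
  not a single point. If it is, \<open>A = \<nu> I\<close> and \<open>b = 0\<close>, the degenerate case.

  For the eigenvector weights, the multiplier argument with \<open>b = 0\<close> shows that the minimizers are unit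
  eigenvectors for the smallest eigenvalue. Two of them with positive first element are equal or
  linearly independent, and independence would make the eigenvalue at least a double root of the
  characteristic polynomial (\<open>order_charpoly_ge_2_if_two_eigenvectors\<close>).
\<close>

section \<open>Symmetric matrices and Gram matrices\<close>

lemma nonneg_at_0_if_nonneg_right:
  fixes h :: "real \<Rightarrow> real"
  assumes "isCont h 0" "\<And>t. t > 0 \<Longrightarrow> h t \<ge> 0"
  shows "h 0 \<ge> 0"
proof (rule tendsto_lowerbound)
  show "(h \<longlongrightarrow> h 0) (at_right 0)"
    using assms(1) by (simp add: isCont_def filterlim_at_split)
  show "\<forall>\<^sub>F t in at_right 0. 0 \<le> h t"
    using assms(2) by (auto simp: eventually_at_right_field intro!: exI[of _ 1])
qed simp

lemma symmetric_matrix_inner_swap: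
  fixes A :: "real^'n^'n"
  assumes "transpose A = A"
  shows "x \<bullet> (A *v z) = z \<bullet> (A *v x)"
  by (metis assms dot_lmul_matrix inner_commute transpose_matrix_vector)

lemma inner_gram:
  fixes M :: "real^'n^'m"
  shows "x \<bullet> ((transpose M ** M) *v z) = (M *v x) \<bullet> (M *v z)"
  by (metis dot_lmul_matrix inner_commute matrix_vector_mul_assoc transpose_matrix_vector)

lemma transpose_gram: "transpose (transpose M ** M) = transpose M ** (M :: real^'n^'m)"
  by (simp add: matrix_transpose_mul)

lemma matrix_mul_inv_right:
  fixes A :: "real^'n^'n"
  assumes "invertible A"
  shows "A ** matrix_inv A = mat 1"
  using assms someI_ex[of "\<lambda>B. A ** B = mat 1 \<and> B ** A = mat 1"]
  by (simp add: invertible_def matrix_inv_def)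

section \<open>Quadratic minimization on the unit sphere\<close>

lemma sphere_minimizer_exists:
  fixes A :: "real^'n^'n"
  shows "\<exists>w. is_arg_min (\<lambda>w. w \<bullet> (A *v w) - 2 * (w \<bullet> b)) (\<lambda>w. w \<in> W_E) w"
proof -
  have W: "W_E = sphere (0::real^'n) 1"
    by (auto simp: W_E_def norm_eq_1)
  have ne: "sphere (0::real^'n) 1 \<noteq> {}" by simp
  have "continuous_on (sphere 0 1) (\<lambda>w. w \<bullet> (A *v w) - 2 * (w \<bullet> b))"
    by (intro continuous_intros linear_continuous_on_compose linear_linear[THEN iffD1] matrix_vector_mul_linear)
      (auto simp: matrix_vector_mul_linear)
  from continuous_attains_inf[OF compact_sphere ne this] show ?thesis
    unfolding W by (force simp: is_arg_min_linorder)
qed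

text \<open>
  Both conclusions come from one inequality, obtained by comparing \<open>w\<close> with its reflection in the
  hyperplane orthogonal to \<open>v\<close>, which is again a unit vector. Letting \<open>v\<close> tend to a tangent vector
  gives stationarity; inserting stationarity leaves semidefiniteness in all directions that are not
  tangent, and the tangent ones follow by continuity.
\<close>

lemma sphere_minimizer_multiplier:
  fixes A :: "real^'n^'n"
  assumes sym: "transpose A = A"
    and min: "is_arg_min (\<lambda>w. w \<bullet> (A *v w) - 2 * (w \<bullet> b)) (\<lambda>w. w \<in> W_E) w"
  obtains \<nu> where "A *v w - \<nu> *\<^sub>R w = b" "\<And>v. \<nu> * (v \<bullet> v) \<le> v \<bullet> (A *v v)"
proof -
  note swap = symmetric_matrix_inner_swap[OF sym]
  have w1: "w \<bullet> w = 1"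
    and le: "\<And>x. x \<bullet> x = 1 \<Longrightarrow> w \<bullet> (A *v w) - 2 * (w \<bullet> b) \<le> x \<bullet> (A *v x) - 2 * (x \<bullet> b)"
    using min by (auto simp: is_arg_min_linorder W_E_def)
  define g where "g = A *v w - b"
  have refl_ineq: "(w \<bullet> v) * (v \<bullet> g) * (v \<bullet> v) \<le> (w \<bullet> v)\<^sup>2 * (v \<bullet> (A *v v))" for v
  proof (cases "v = 0")
    case False
    define s where "s = (w \<bullet> v) / (v \<bullet> v)"
    have s: "w \<bullet> v = s * (v \<bullet> v)" using False by (simp add: s_def)
    define x where "x = w - (2 * s) *\<^sub>R v"
    have "x \<bullet> x = 1"
      using w1 s by (simp add: x_def algebra_simps inner_commute power2_eq_square)
    from le[OF this] have "s * (v \<bullet> g) \<le> s\<^sup>2 * (v \<bullet> (A *v v))"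
      using swap[of w v] by (simp add: x_def g_def matrix_vector_mult_diff_distrib
          matrix_vector_mult_scaleR algebra_simps power2_eq_square inner_commute[of b])
    then have "(s * (v \<bullet> g)) * (v \<bullet> v)\<^sup>2 \<le> (s\<^sup>2 * (v \<bullet> (A *v v))) * (v \<bullet> v)\<^sup>2"
      by (rule mult_right_mono) simp
    then show ?thesis unfolding s by (simp add: power2_eq_square mult_ac)
  qed simp
  \<comment> \<open>For \<open>v = u + t w\<close> the factor \<open>w \<bullet> v\<close> is \<open>t\<close>; divide by it and let \<open>t\<close> decrease to 0.\<close>
  have tangent: "u \<bullet> g \<le> 0" if u: "w \<bullet> u = 0" for u
  proof (cases "u = 0")
    case False
    define h where "h t = t * ((u + t *\<^sub>R w) \<bullet> (A *v u + t *\<^sub>R (A *v w)))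
      - ((u + t *\<^sub>R w) \<bullet> g) * ((u + t *\<^sub>R w) \<bullet> (u + t *\<^sub>R w))" for t
    have "h 0 \<ge> 0"
    proof (rule nonneg_at_0_if_nonneg_right)
      show "isCont h 0" unfolding h_def by (intro continuous_intros)
      fix t :: real assume t: "t > 0"
      have wt: "w \<bullet> (u + t *\<^sub>R w) = t" using u w1 by (simp add: inner_add_right)
      have "t * h t \<ge> 0"
        using refl_ineq[of "u + t *\<^sub>R w"] unfolding wt
        by (simp add: h_def matrix_vector_right_distrib matrix_vector_mult_scaleR
            right_diff_distrib power2_eq_square mult.assoc)
      then show "h t \<ge> 0" using t by (simp add: zero_le_mult_iff)
    qed
    then have "(u \<bullet> g) * (u \<bullet> u) \<le> 0" by (simp add: h_def)
    moreover have "u \<bullet> u > 0" using False by simp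
    ultimately show ?thesis by (simp add: mult_le_0_iff)
  qed simp
  define \<nu> where "\<nu> = w \<bullet> g"
  define u where "u = g - \<nu> *\<^sub>R w"
  have "w \<bullet> u = 0" using w1 by (simp add: u_def \<nu>_def inner_diff_right)
  moreover have "u \<bullet> u = u \<bullet> g - \<nu> * (w \<bullet> u)"
    by (simp add: u_def inner_diff_right inner_diff_left inner_commute[of g w])
  ultimately have "u \<bullet> u \<le> 0" using tangent[of u] by simp
  then have "u = 0" by (metis inner_gt_zero_iff not_le)
  then have g: "g = \<nu> *\<^sub>R w" by (simp add: u_def)
  have psd: "\<nu> * (v \<bullet> v) \<le> v \<bullet> (A *v v)" if "w \<bullet> v \<noteq> 0" for v
  proof -
    have "(w \<bullet> v)\<^sup>2 * (\<nu> * (v \<bullet> v)) \<le> (w \<bullet> v)\<^sup>2 * (v \<bullet> (A *v v))"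
      using refl_ineq[of v] by (simp add: g power2_eq_square mult_ac inner_commute)
    then show ?thesis using that by simp
  qed
  have "\<nu> * (v \<bullet> v) \<le> v \<bullet> (A *v v)" for v
  proof (cases "w \<bullet> v = 0")
    case True
    define h where "h t = (v + t *\<^sub>R w) \<bullet> (A *v v + t *\<^sub>R (A *v w))
      - \<nu> * ((v + t *\<^sub>R w) \<bullet> (v + t *\<^sub>R w))" for t
    have "h 0 \<ge> 0"
    proof (rule nonneg_at_0_if_nonneg_right)
      show "isCont h 0" unfolding h_def by (intro continuous_intros)
      fix t :: real assume "t > 0"
      then have "w \<bullet> (v + t *\<^sub>R w) \<noteq> 0" using True w1 by (simp add: inner_add_right)
      from psd[OF this] show "h t \<ge> 0"
        by (simp add: h_def matrix_vector_right_distrib matrix_vector_mult_scaleR)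
    qed
    then show ?thesis by (simp add: h_def)
  qed (rule psd)
  moreover have "A *v w - \<nu> *\<^sub>R w = b" using g by (simp add: g_def algebra_simps)
  ultimately show ?thesis using that by blast
qed

section \<open>Extreme eigenvalues and Rayleigh quotients\<close>

lemma eigenvalue_ge_rayleigh_bound:
  fixes A :: "real^'n^'n"
  assumes "\<And>v. c * (v \<bullet> v) \<le> v \<bullet> (A *v v)" "eigenvalue A l"
  shows "c \<le> l"
proof -
  from assms(2) obtain v where v: "v \<noteq> 0" "A *v v = l *\<^sub>R v" by (auto simp: eigenvalue_def)
  then show ?thesis using assms(1)[of v] by simp
qed

text \<open>
  The multiplier of a minimizer of \<open>w \<bullet> A w\<close> on the sphere is an eigenvalue, and semidefiniteness is
  the Rayleigh bound for it.
\<close>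

lemma symmetric_least_eigenvalue:
  fixes A :: "real^'n^'n"
  assumes "transpose A = A"
  obtains l where "eigenvalue A l" "\<And>v. l * (v \<bullet> v) \<le> v \<bullet> (A *v v)"
proof -
  obtain w where w: "is_arg_min (\<lambda>w. w \<bullet> (A *v w) - 2 * (w \<bullet> 0)) (\<lambda>w. w \<in> W_E) w"
    using sphere_minimizer_exists by blast
  obtain l where l: "A *v w - l *\<^sub>R w = 0" "\<And>v. l * (v \<bullet> v) \<le> v \<bullet> (A *v v)"
    using sphere_minimizer_multiplier[OF assms w] by blast
  have "w \<noteq> 0" using w by (auto simp: is_arg_min_def W_E_def)
  then have "eigenvalue A l" using l(1) by (auto simp: eigenvalue_def)
  then show ?thesis using l(2) that by blast
qed

text \<open>
  The eigenvalues are the roots of the characteristic polynomial; it is not the zero polynomial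
  because numbers below the Rayleigh bound are not eigenvalues.
\<close>

lemma finite_eigenvalues:
  fixes A :: "real^'n^'n"
  assumes "transpose A = A"
  shows "finite {l. eigenvalue A l}"
proof -
  obtain m where "\<And>v. m * (v \<bullet> v) \<le> v \<bullet> (A *v v)"
    using symmetric_least_eigenvalue[OF assms] by blast
  then have "\<not> eigenvalue A (m - 1)"
    using eigenvalue_ge_rayleigh_bound by fastforce
  then have "charpoly A \<noteq> 0" by (auto simp: eigenvalue_iff_root)
  then show ?thesis unfolding eigenvalue_iff_root by (rule poly_roots_finite)
qed

lemma lambda_min_eqI:
  fixes A :: "real^'n^'n"
  assumes "transpose A = A" "eigenvalue A l" "\<And>v. l * (v \<bullet> v) \<le> v \<bullet> (A *v v)"
  shows "lambda_min A = l"
  unfolding lambda_min_def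
  using assms finite_eigenvalues eigenvalue_ge_rayleigh_bound[OF assms(3)] by (intro Min_eqI) auto

lemma lambda_min_le_rayleigh:
  fixes A :: "real^'n^'n"
  assumes "transpose A = A"
  shows "lambda_min A * (v \<bullet> v) \<le> v \<bullet> (A *v v)"
  using symmetric_least_eigenvalue[OF assms] lambda_min_eqI[OF assms] by metis

lemma rayleigh_le_lambda_max:
  fixes A :: "real^'n^'n"
  assumes sym: "transpose A = A"
  shows "v \<bullet> (A *v v) \<le> lambda_max A * (v \<bullet> v)"
proof -
  have neg: "(- A) *v v = - (A *v v)" for v
    using matrix_vector_mult_diff_rdistrib[of 0 A v] by simp
  have "transpose (- A) = - A" using sym by (simp add: transpose_def vec_eq_iff)
  then obtain l where l: "eigenvalue (- A) l" "\<And>v. l * (v \<bullet> v) \<le> v \<bullet> ((- A) *v v)"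
    using symmetric_least_eigenvalue by blast
  have "eigenvalue A (- l)"
    using l(1) unfolding eigenvalue_def neg by (metis add.inverse_inverse scaleR_minus_left)
  then have "- l \<le> lambda_max A"
    unfolding lambda_max_def using finite_eigenvalues[OF sym] by (intro Max_ge) auto
  then have "- l * (v \<bullet> v) \<le> lambda_max A * (v \<bullet> v)" by (intro mult_right_mono) auto
  moreover have "v \<bullet> (A *v v) \<le> - l * (v \<bullet> v)" using l(2)[of v] by (simp add: neg)
  ultimately show ?thesis by simp
qed

text \<open>
  The normalized vector attains the lower bound \<open>\<nu>\<close> of the Rayleigh quotient, so it minimizes
  \<open>w \<bullet> A w\<close> on the sphere and is an eigenvector.
\<close>

lemma psd_null_vector_is_eigenvector:
  fixes A :: "real^'n^'n"
  assumes sym: "transpose A = A" and psd: "\<And>v. \<nu> * (v \<bullet> v) \<le> v \<bullet> (A *v v)"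
    and null: "d \<bullet> (A *v d) = \<nu> * (d \<bullet> d)"
  shows "A *v d = \<nu> *\<^sub>R d"
proof (cases "d = 0")
  case False
  define w where "w = inverse (norm d) *\<^sub>R d"
  have w: "w \<bullet> w = 1" "w \<bullet> (A *v w) = \<nu>"
    using False null
    by (auto simp: w_def matrix_vector_mult_scaleR dot_square_norm power2_eq_square field_simps)
  have "is_arg_min (\<lambda>w. w \<bullet> (A *v w) - 2 * (w \<bullet> 0)) (\<lambda>w. w \<in> W_E) w"
    using w psd by (auto simp: is_arg_min_linorder W_E_def) (metis mult.right_neutral)
  then obtain \<mu> where \<mu>: "A *v w - \<mu> *\<^sub>R w = 0"
    using sphere_minimizer_multiplier[OF sym] by blast
  then have Aw: "A *v w = \<mu> *\<^sub>R w" by simp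
  then have "\<mu> = \<nu>" using w by simp
  moreover have "d = norm d *\<^sub>R w" using False by (simp add: w_def)
  ultimately show ?thesis using Aw by (metis matrix_vector_mult_scaleR scaleR_left_commute)
qed simp

section \<open>Uniqueness on the unit sphere\<close>

text \<open>
  Replacing \<open>x0\<close> by its component \<open>p\<close> orthogonal to the eigenspace \<open>E\<close> of \<open>l\<close> keeps \<open>(A - l I) p = b\<close> and
  does not increase the norm. The orthogonal complement \<open>E'\<close> of \<open>E\<close> is invariant under \<open>A\<close>, and on it
  \<open>A - l I\<close> is bounded below by some \<open>c > 0\<close>. Therefore \<open>A - (l + \<epsilon>) I\<close> is invertible for small
  \<open>\<epsilon> > 0\<close>, and the solution of \<open>(A - (l + \<epsilon>) I) x = b\<close> lies in \<open>E'\<close> at distance at most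
  \<open>\<epsilon> norm p / (c - \<epsilon>)\<close> from \<open>p\<close>.
\<close>

lemma resolvent_small_right_of_eigenvalue:
  fixes A :: "real^'n^'n"
  assumes sym: "transpose A = A" and x0: "A *v x0 - l *\<^sub>R x0 = b" and n: "norm x0 < 1" and lm: "l < m"
  obtains \<nu> where "l < \<nu>" "\<nu> < m" "invertible (A - \<nu> *\<^sub>R mat 1)"
    "norm (matrix_inv (A - \<nu> *\<^sub>R mat 1) *v b) < 1"
proof -
  note swap = symmetric_matrix_inner_swap[OF sym]
  define E where "E = {v. A *v v = l *\<^sub>R v}"
  define E' where "E' = {x. \<forall>e\<in>E. orthogonal e x}"
  define L where "L x = A *v x - l *\<^sub>R x" for x
  have lin: "linear L" unfolding L_def
    by (intro linear_compose_sub matrix_vector_mul_linear linear_scaleR)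
  have subE: "subspace E" unfolding E_def
    by (auto simp: subspace_def matrix_vector_right_distrib matrix_vector_mult_scaleR algebra_simps)
  have subE': "subspace E'" unfolding E'_def by (rule subspace_orthogonal_to_vectors)
  have split: "\<exists>e z. x = e + z \<and> e \<in> E \<and> z \<in> E'" for x
  proof -
    obtain e z where "e \<in> span E" "\<And>w. w \<in> span E \<Longrightarrow> orthogonal z w" "x = e + z"
      using orthogonal_subspace_decomp_exists[of E x] by metis
    moreover have "span E = E" using subE by (simp add: span_eq_iff)
    ultimately have "e \<in> E" "z \<in> E'" by (auto simp: E'_def orthogonal_commute)
    then show ?thesis using \<open>x = e + z\<close> by blast
  qed
  have L_range: "L x \<in> E'" for x
    unfolding E'_def E_def L_def orthogonal_def
    using swap[of _ x] by (auto simp: inner_diff_right inner_commute)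
  have disj: "x = 0" if "x \<in> E" "x \<in> E'" for x
    using that unfolding E'_def by (auto simp: orthogonal_def)
  obtain c where c: "c > 0" "\<And>x. x \<in> E' \<Longrightarrow> c * norm x \<le> norm (L x)"
  proof -
    have "\<exists>e>0. \<forall>x\<in>E'. norm (L x) \<ge> e * norm x"
    proof (rule injective_imp_isometric)
      show "closed E'" by (rule closed_subspace[OF subE'])
      show "bounded_linear L" using lin linear_linear by blast
      show "\<forall>x\<in>E'. L x = 0 \<longrightarrow> x = 0" using disj by (auto simp: L_def E_def)
    qed (rule subE')
    then show ?thesis using that by blast
  qed
  obtain e0 p where p: "x0 = e0 + p" "e0 \<in> E" "p \<in> E'" using split by blast
  have Lp: "L p = b"
    using p x0 by (simp add: L_def E_def matrix_vector_right_distrib algebra_simps)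
  have "norm p \<le> norm x0"
  proof -
    have "orthogonal e0 p" using p(2,3) by (simp add: E'_def)
    from norm_add_Pythagorean[OF this]
    have "(norm x0)\<^sup>2 = (norm e0)\<^sup>2 + (norm p)\<^sup>2" by (simp only: p(1))
    then have "(norm p)\<^sup>2 \<le> (norm x0)\<^sup>2" by simp
    then show ?thesis by (rule power2_le_imp_le) simp
  qed
  then have p1: "norm p < 1" using n by simp
  \<comment> \<open>The second bound makes \<open>c * norm p / (c - \<epsilon>)\<close>, which bounds the solution, less than 1.\<close>
  define \<epsilon> where "\<epsilon> = min ((m - l) / 2) (c * (1 - norm p) / 2)"
  have \<epsilon>: "\<epsilon> > 0" "\<epsilon> < m - l" "\<epsilon> \<le> c * (1 - norm p) / 2"
    using lm c p1 by (auto simp: \<epsilon>_def min_less_iff_disj)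
  have "\<epsilon> < c * (1 - norm p)" using \<epsilon>(3) mult_pos_pos[of c "1 - norm p"] c p1 by linarith
  then have \<epsilon>c: "\<epsilon> + c * norm p < c" by (simp add: algebra_simps)
  moreover have "c * norm p \<ge> 0" using c by simp
  ultimately have \<epsilon>c': "\<epsilon> < c" by linarith
  define N where "N = A - (l + \<epsilon>) *\<^sub>R mat 1"
  have N: "N *v x = L x - \<epsilon> *\<^sub>R x" for x
    by (simp add: N_def L_def matrix_vector_mult_diff_rdistrib scaleR_matrix_vector_assoc[symmetric]
        algebra_simps)
  have in_E': "x \<in> E'" if "N *v x \<in> E'" for x
  proof -
    have "\<epsilon> *\<^sub>R x = L x - N *v x" by (simp add: N)
    also have "\<dots> \<in> E'" by (intro subspace_diff subE' L_range that)
    finally have "(1 / \<epsilon>) *\<^sub>R (\<epsilon> *\<^sub>R x) \<in> E'" by (rule subspace_scale[OF subE'])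
    then show ?thesis using \<epsilon> by simp
  qed
  have bound: "(c - \<epsilon>) * norm x \<le> norm (N *v x)" if "x \<in> E'" for x
  proof -
    have "norm (L x) - norm (\<epsilon> *\<^sub>R x) \<le> norm (N *v x)" unfolding N by (rule norm_triangle_ineq2)
    then show ?thesis using c(2)[OF that] \<epsilon> by (simp add: algebra_simps)
  qed
  have inv: "invertible N"
    unfolding invertible_left_inverse matrix_left_invertible_ker
  proof (intro allI impI)
    fix x assume x: "N *v x = 0"
    then have "x \<in> E'" using in_E' subspace_0[OF subE'] by simp
    from bound[OF this] x \<epsilon>c' show "x = 0" by (simp add: mult_le_0_iff)
  qed
  define x where "x = matrix_inv N *v b"
  have "N ** matrix_inv N = mat 1" using inv by (rule matrix_mul_inv_right)
  then have Nx: "N *v x = b" by (simp add: x_def matrix_vector_mul_assoc)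
  have "x \<in> E'" using in_E'[of x] L_range[of p] unfolding Nx Lp by simp
  then have "x - p \<in> E'" using p subE' by (intro subspace_diff)
  from bound[OF this] have "(c - \<epsilon>) * norm (x - p) \<le> norm (\<epsilon> *\<^sub>R p)"
    using Nx N[of p] Lp by (simp add: matrix_vector_mult_diff_distrib)
  then have 1: "(c - \<epsilon>) * norm (x - p) \<le> \<epsilon> * norm p" using \<epsilon> by simp
  have "norm x \<le> norm (x - p) + norm p" using norm_triangle_ineq[of "x - p" p] by simp
  then have "(c - \<epsilon>) * norm x \<le> (c - \<epsilon>) * (norm (x - p) + norm p)"
    using \<epsilon>c' by (intro mult_left_mono) auto
  also have "\<dots> \<le> c * norm p" using 1 by (simp add: algebra_simps)
  also have "\<dots> < (c - \<epsilon>) * 1" using \<epsilon>c by simp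
  finally have "norm x < 1" using \<epsilon>c' by (simp add: mult_less_cancel_left_pos)
  then show ?thesis using that[of "l + \<epsilon>"] \<epsilon> inv by (simp add: x_def N_def)
qed

text \<open>
  Two minimizers differ by an eigenvector for the smallest eigenvalue, so their midpoint is a short
  solution of the stationarity equation, in conflict with the resolvent condition.
\<close>

lemma unique_sphere_minimizer:
  fixes A :: "real^'n^'n"
  assumes sym: "transpose A = A" and cond: "resolvent_cond A b" and nd: "nondegenerate A b"
  shows "\<exists>!w. is_arg_min (\<lambda>w. w \<bullet> (A *v w) - 2 * (w \<bullet> b)) (\<lambda>w. w \<in> W_E) w"
proof (rule ex_ex1I[OF sphere_minimizer_exists], rule ccontr)
  note swap = symmetric_matrix_inner_swap[OF sym]
  let ?q = "\<lambda>w. w \<bullet> (A *v w) - 2 * (w \<bullet> b)"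
  fix w w'
  assume w: "is_arg_min ?q (\<lambda>w. w \<in> W_E) w" and w': "is_arg_min ?q (\<lambda>w. w \<in> W_E) w'"
    and ne: "w \<noteq> w'"
  have unit: "w \<bullet> w = 1" "w' \<bullet> w' = 1" and q: "?q w = ?q w'"
    using w w' by (auto simp: is_arg_min_linorder W_E_def intro: order_antisym)
  obtain \<nu> where \<nu>: "A *v w - \<nu> *\<^sub>R w = b" "\<And>v. \<nu> * (v \<bullet> v) \<le> v \<bullet> (A *v v)"
    using sphere_minimizer_multiplier[OF sym w] by blast
  define d where "d = w' - w"
  have d0: "d \<noteq> 0" using ne by (simp add: d_def)
  have "d \<bullet> (A *v d) = \<nu> * (d \<bullet> d)"
    using q unit swap[of w w'] unfolding \<nu>(1)[symmetric] d_def
    by (simp add: matrix_vector_mult_diff_distrib inner_diff inner_commute algebra_simps)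
  then have Ad: "A *v d = \<nu> *\<^sub>R d" by (rule psd_null_vector_is_eigenvector[OF sym \<nu>(2)])
  then have lmin: "lambda_min A = \<nu>"
    using d0 \<nu>(2) by (intro lambda_min_eqI[OF sym]) (auto simp: eigenvalue_def)
  show False
  proof (cases "lambda_min A < lambda_max A")
    case True
    \<comment> \<open>The midpoint of two distinct unit vectors lies strictly inside the unit ball.\<close>
    define x0 where "x0 = w + (1/2) *\<^sub>R d"
    have "A *v x0 - \<nu> *\<^sub>R x0 = b"
      using \<nu>(1) Ad by (simp add: x0_def matrix_vector_right_distrib matrix_vector_mult_scaleR algebra_simps)
    moreover have "norm x0 < 1"
    proof -
      have "x0 \<bullet> x0 = 1 - (d \<bullet> d) / 4"
        using unit by (simp add: x0_def d_def inner_diff inner_add inner_commute field_simps)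
      also have "\<dots> < 1" using d0 by simp
      finally show ?thesis by (simp add: norm_lt_square)
    qed
    ultimately obtain \<mu> where "\<nu> < \<mu>" "\<mu> < lambda_max A" "invertible (A - \<mu> *\<^sub>R mat 1)"
      "norm (matrix_inv (A - \<mu> *\<^sub>R mat 1) *v b) < 1"
      using resolvent_small_right_of_eigenvalue[OF sym] True lmin by metis
    then show False using cond lmin by (force simp: resolvent_cond_def)
  next
    case False
    then have "lambda_max A * (w \<bullet> w) \<le> \<nu> * (w \<bullet> w)" using lmin by (intro mult_right_mono) auto
    \<comment> \<open>The Rayleigh quotient is squeezed between equal extreme eigenvalues.\<close>
    then have "w \<bullet> (A *v w) = \<nu> * (w \<bullet> w)"
      using rayleigh_le_lambda_max[OF sym, of w] \<nu>(2)[of w] by simp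
    then have "A *v w = \<nu> *\<^sub>R w" by (rule psd_null_vector_is_eigenvector[OF sym \<nu>(2)])
    then have "b = 0" using \<nu>(1) by simp
    then show False using nd False by (simp add: nondegenerate_def)
  qed
qed

section \<open>Uniqueness on closed convex sets\<close>

lemma unique_least_squares:
  fixes L :: "'a::euclidean_space \<Rightarrow> 'b::euclidean_space"
  assumes "linear L" "inj L" "closed W" "convex W" "W \<noteq> {}"
  shows "\<exists>!w. is_arg_min (\<lambda>w. (norm (a - L w))\<^sup>2) (\<lambda>w. w \<in> W) w"
proof -
  have cl: "closed (L ` W)" by (rule closed_injective_linear_image) fact+
  have cv: "convex (L ` W)" by (rule convex_linear_image) fact+
  have iff: "is_arg_min (\<lambda>w. (norm (a - L w))\<^sup>2) (\<lambda>w. w \<in> W) w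
      \<longleftrightarrow> w \<in> W \<and> (\<forall>z\<in>L ` W. dist a (L w) \<le> dist a z)" for w
    unfolding is_arg_min_linorder dist_norm ball_simps
    by (simp add: abs_le_square_iff[symmetric] Ball_def)
  show ?thesis
    unfolding iff
  proof (rule ex_ex1I)
    show "\<exists>w. w \<in> W \<and> (\<forall>z\<in>L ` W. dist a (L w) \<le> dist a z)"
    proof -
      obtain z where "z \<in> L ` W" "\<And>x. x \<in> L ` W \<Longrightarrow> dist a z \<le> dist a x"
        using distance_attains_inf[OF cl, of a] assms(5) by auto
      then show ?thesis by (elim imageE) auto
    qed
    fix w w' assume w: "w \<in> W \<and> (\<forall>z\<in>L ` W. dist a (L w) \<le> dist a z)"
      and w': "w' \<in> W \<and> (\<forall>z\<in>L ` W. dist a (L w') \<le> dist a z)"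
    have "L w = L w'"
      by (rule any_closest_point_unique[OF cv cl _ _ conjunct2[OF w] conjunct2[OF w']])
        (use w w' in blast)+
    then show "w = w'" using assms(2) by (simp add: inj_eq)
  qed
qed

lemma inj_if_lambda_min_gram_pos:
  fixes M :: "real^'n^'m"
  assumes "lambda_min (scaled_gram M) > 0"
  shows "inj ((*v) M)"
proof -
  have "transpose (scaled_gram M) = scaled_gram M"
    by (simp add: scaled_gram_def transpose_scalar transpose_gram)
  note rayleigh = lambda_min_le_rayleigh[OF this]
  have "v = 0" if "M *v v = 0" for v
  proof -
    have "v \<bullet> (scaled_gram M *v v) = 0"
      using that inner_gram[of v M v]
      by (simp add: scaled_gram_def scaleR_matrix_vector_assoc[symmetric])
    with rayleigh[of v] assms have "v \<bullet> v \<le> 0" by (simp add: mult_le_0_iff)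
    then show ?thesis by (metis inner_gt_zero_iff not_le)
  qed
  then show ?thesis
    by (simp add: linear_injective_0)
qed

text \<open>
  The Gram matrix is invertible, so \<open>\<psi>\<close> can be absorbed by completing the square: up to a constant
  the criterion is the squared distance between \<open>F w\<close> and \<open>F u\<close>, where \<open>u\<close> is the unconstrained
  minimizer.
\<close>

lemma unique_ma_closed_convex:
  fixes F :: "real^'s^'t"
  assumes inj: "inj ((*v) F)" and "closed W" "convex W" "W \<noteq> {}"
  shows "\<exists>!w. is_w_ma W y F \<psi> w"
proof -
  let ?G = "transpose F ** F"
  have "invertible ?G"
    unfolding invertible_left_inverse matrix_left_invertible_ker
    using inner_gram[of _ F] inj by (metis inner_eq_zero_iff inner_zero_right inj_eq matrix_vector_mult_0_right)
  then obtain u where u: "?G *v u = - \<psi>"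
    by (metis matrix_mul_inv_right matrix_vector_mul_assoc matrix_vector_mul_lid)
  have crit: "mallows_crit y F \<psi> w = (norm (F *v u - F *v w))\<^sup>2 + (y \<bullet> y - (F *v u) \<bullet> (F *v u))" for w
  proof -
    have "w \<bullet> \<psi> = - (w \<bullet> (?G *v u))" by (simp only: u inner_minus_right minus_minus)
    also have "w \<bullet> (?G *v u) = (F *v w) \<bullet> (F *v u)" by (rule inner_gram)
    finally have "w \<bullet> \<psi> = - ((F *v w) \<bullet> (F *v u))" .
    moreover have "(norm (F *v u - F *v w))\<^sup>2
        = (F *v u) \<bullet> (F *v u) - 2 * ((F *v w) \<bullet> (F *v u)) + (F *v w) \<bullet> (F *v w)"
      by (simp add: power2_norm_eq_inner inner_diff_left inner_diff_right inner_commute[of "F *v u" "F *v w"])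
    ultimately show ?thesis unfolding mallows_crit_def inner_gram by simp
  qed
  show ?thesis
    using unique_least_squares[OF matrix_vector_mul_linear assms, of "F *v u"]
    unfolding is_w_ma_def is_arg_min_def crit add_less_cancel_right .
qed

section \<open>Specialization to the combination weights\<close>

text \<open>This carries uniqueness from the Mallows criterion over to regression and, as both have the
  same form, to cross-validation.\<close>

lemma is_w_reg_eq_ma: "is_w_reg W y F = is_w_ma W y F (- (transpose F *v y))"
proof -
  have "w \<bullet> (transpose F *v y) = y \<bullet> (F *v w)" for w
    by (simp add: dot_lmul_matrix inner_commute[of w])
  then have "(norm (y - F *v w))\<^sup>2 = mallows_crit y F (- (transpose F *v y)) w" for w
    by (simp add: mallows_crit_def inner_gram power2_norm_eq_inner inner_diff inner_commute)
  then show ?thesis by (simp add: is_w_reg_def is_w_ma_def fun_eq_iff)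
qed

lemma is_w_cv_eq_reg: "is_w_cv W y F = is_w_reg W y F"
  by (simp add: is_w_cv_def is_w_reg_def fun_eq_iff)

lemma weight_spaces_closed_convex:
  assumes "W \<in> {W_A, W_B, W_C, W_D :: (real^'s) set}"
  shows "closed W" "convex W" "W \<noteq> {}"
proof -
  have C: "W_C = cbox (0::real^'s) 1"
    by (auto simp: W_C_def mem_box_cart)
  have B: "W_B = {w::real^'s. 1 \<bullet> w = 1}" by (simp add: W_B_def inner_commute)
  have D: "W_D = W_C \<inter> (W_B :: (real^'s) set)" by (auto simp: W_D_def W_C_def B)
  have "closed (W_B :: (real^'s) set)" "convex (W_B :: (real^'s) set)"
    unfolding B by (rule closed_hyperplane, rule convex_hyperplane)
  then show "closed W" "convex W"
    using assms by (auto simp: W_A_def C D intro: convex_Int closed_Int)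
  obtain s :: 's where True by simp
  have "axis s 1 \<in> (W_D :: (real^'s) set)"
    by (auto simp: W_D_def axis_def inner_vec_def)
  then show "W \<noteq> {}" using assms by (auto simp: D W_A_def)
qed

text \<open>
  The Mallows criterion is \<open>w \<bullet> A w - 2 (w \<bullet> b)\<close> for \<open>b = - \<psi>\<close>, whereas the resolvent condition is
  stated for \<open>\<psi>\<close>; the sign is immaterial.
\<close>

lemma resolvent_cond_minus: "resolvent_cond A (- b) = resolvent_cond A b"
  for A :: "real^'n^'n"
proof -
  have neg: "N *v (- b) = - (N *v b)" for N :: "real^'n^'n"
    using matrix_vector_mult_diff_distrib[of N 0 b] by simp
  then show ?thesis by (simp add: resolvent_cond_def)
qed

lemma unique_ma_sphere:
  fixes F :: "real^'s^'t"
  assumes "resolvent_cond (transpose F ** F) \<psi>" "nondegenerate (transpose F ** F) \<psi>"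
  shows "\<exists>!w. is_w_ma W_E y F \<psi> w"
proof -
  let ?G = "transpose F ** F"
  have "resolvent_cond ?G (- \<psi>)" "nondegenerate ?G (- \<psi>)"
    using assms by (simp_all add: resolvent_cond_minus nondegenerate_def)
  from unique_sphere_minimizer[OF transpose_gram this]
  show ?thesis
    by (simp add: is_w_ma_def mallows_crit_def is_arg_min_def)
qed

lemma unique_intercept:
  fixes F :: "real^'s^'t"
  assumes "lambda_min (scaled_gram (add_intercept F)) > 0"
  shows "\<exists>!p. is_w_reg_intercept y F p"
proof -
  define L :: "real \<times> (real^'s) \<Rightarrow> real^'t" where "L p = fst p *\<^sub>R 1 + F *v snd p" for p
  define J :: "real \<times> (real^'s) \<Rightarrow> real^('s option)" where
    "J p = (\<chi> j. case j of None \<Rightarrow> fst p | Some s \<Rightarrow> snd p $ s)" for p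
  have "L p = add_intercept F *v J p" for p
    by (simp add: L_def J_def add_intercept_def matrix_vector_mult_def vec_eq_iff UNIV_option_conv
        sum.reindex)
  then have "L = (*v) (add_intercept F) \<circ> J" by (simp add: fun_eq_iff)
  moreover have "inj J"
  proof (rule injI)
    fix p q assume "J p = J q"
    then have "J p $ j = J q $ j" for j by simp
    from this[of None] this[of "Some _"] show "p = q"
      by (simp add: J_def prod_eq_iff vec_eq_iff)
  qed
  ultimately have "inj L"
    using inj_if_lambda_min_gram_pos[OF assms] by (simp add: inj_compose)
  moreover have "linear L"
    by (auto simp: L_def linear_iff algebra_simps matrix_vector_right_distrib matrix_vector_mult_scaleR)
  ultimately have "\<exists>!p. is_arg_min (\<lambda>p. (norm (y - L p))\<^sup>2) (\<lambda>p. p \<in> UNIV) p"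
    by (intro unique_least_squares) auto
  then show ?thesis
    by (simp add: is_w_reg_intercept_def L_def case_prod_unfold diff_diff_eq)
qed

section \<open>Simple roots of the characteristic polynomial\<close>

text \<open>
  The geometric multiplicity of an eigenvalue is at most its algebraic multiplicity, for two
  independent eigenvectors. Replace the columns \<open>i\<close> and \<open>j\<close> of the identity matrix by \<open>u\<close> and \<open>v\<close>,
  where \<open>v $ j \<noteq> 0\<close>. The resulting matrix \<open>P\<close> is invertible, since \<open>v $ i = 0\<close> makes the relevant
  minor triangular, and the columns \<open>i\<close> and \<open>j\<close> of \<open>(X I - A) P\<close> are \<open>(X - l) u\<close> and \<open>(X - l) v\<close>.
  So \<open>(X - l)\<^sup>2\<close> divides its determinant, which is a nonzero constant times the characteristic
  polynomial.
\<close>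

lemma order_charpoly_ge_2_if_two_eigenvectors:
  fixes A :: "real^'n^'n"
  assumes u: "A *v u = l *\<^sub>R u" and v: "A *v v = l *\<^sub>R v"
    and i: "u $ i \<noteq> 0" "v $ i = 0" and v0: "v \<noteq> 0" and nz: "charpoly A \<noteq> 0"
  shows "order l (charpoly A) \<ge> 2"
proof -
  obtain j where j: "v $ j \<noteq> 0" using v0 by (auto simp: vec_eq_iff)
  then have ij: "i \<noteq> j" using i by auto
  define P :: "real^'n^'n" where
    "P = (\<chi> r c. if c = i then u $ r else if c = j then v $ r else mat 1 $ r $ c)"
  define Pc :: "real poly^'n^'n" where "Pc = (\<chi> r c. [:P $ r $ c:])"
  define X :: "real poly^'n^'n" where "X = mat [:0, 1:] - (\<chi> i j. [:A $ i $ j:])"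
  have "invertible P"
    unfolding invertible_left_inverse matrix_left_invertible_ker
  proof (intro allI impI)
    fix x assume x: "P *v x = 0"
    have "x $ i * u $ k + x $ j * v $ k + (if k = i \<or> k = j then 0 else x $ k) = 0" for k
    proof -
      have "(P *v x) $ k = (\<Sum>c\<in>UNIV. (if c = i then x $ i * u $ k else 0)
          + (if c = j then x $ j * v $ k else 0)
          + (if c = k then (if k = i \<or> k = j then 0 else x $ k) else 0))"
        unfolding matrix_vector_mult_def P_def using ij
        by (auto simp: mat_def intro!: sum.cong)
      then show ?thesis unfolding x by (simp add: sum.distrib)
    qed
    note k = this
    have "x $ i = 0" using k[of i] i by simp
    moreover from this have "x $ j = 0" using k[of j] j by simp
    ultimately have "x $ k = 0" for k using k[of k] by (cases "k = i \<or> k = j") auto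
    then show "x = 0" by (simp add: vec_eq_iff)
  qed
  then have "det P \<noteq> 0" by (simp add: invertible_det_nz)
  moreover have "poly (det Pc) x = det P" for x
    unfolding Pc_def det_def by (auto simp: poly_sum poly_prod intro!: sum.cong prod.cong)
  ultimately have detPc: "poly (det Pc) l \<noteq> 0" by simp
  \<comment> \<open>The transpose turns the two columns into rows, for the row linearity of the determinant.\<close>
  define B where "B = transpose (X ** Pc)"
  have col: "B $ c = [:- l, 1:] *s (\<chi> k. [:z $ k:])"
    if z: "A *v z = l *\<^sub>R z" and c: "\<And>r. P $ r $ c = z $ r" for c z
  proof -
    have "B $ c $ k = [:- l, 1:] * [:z $ k:]" for k
    proof -
      have "B $ c $ k = (\<Sum>r\<in>UNIV. ((if k = r then [:0, 1:] else 0) - [:A $ k $ r:]) * [:z $ r:])"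
        by (simp add: B_def transpose_def matrix_matrix_mult_def X_def Pc_def mat_def c)
      also have "\<dots> = (\<Sum>r\<in>UNIV. if k = r then [:0, 1:] * [:z $ r:] else 0)
          - (\<Sum>r\<in>UNIV. [:A $ k $ r * z $ r:])"
        unfolding sum_subtractf[symmetric] by (intro sum.cong) auto
      also have "(\<Sum>r\<in>UNIV. if k = r then [:0, 1:] * [:z $ r:] else 0) = [:0, 1:] * [:z $ k:]"
        by (rule trans[OF sum.delta']) simp_all
      also have "(\<Sum>r\<in>UNIV. [:A $ k $ r * z $ r:]) = [:(A *v z) $ k:]"
        by (simp add: matrix_vector_mult_def sum_to_poly)
      finally show ?thesis by (simp add: z)
    qed
    then show ?thesis by (simp add: vec_eq_iff)
  qed
  have Bi: "B $ i = [:- l, 1:] *s (\<chi> k. [:u $ k:])" by (rule col[OF u]) (simp add: P_def)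
  have Bj: "B $ j = [:- l, 1:] *s (\<chi> k. [:v $ k:])" by (rule col[OF v]) (use ij in \<open>simp add: P_def\<close>)
  define C where "C = (\<chi> r. if r = j then (\<chi> k. [:v $ k:]) else B $ r)"
  have "det B = det (\<chi> r. if r = j then [:- l, 1:] *s (\<chi> k. [:v $ k:]) else B $ r)"
    by (rule arg_cong[of _ _ det]) (simp add: vec_eq_iff Bj)
  also have "\<dots> = [:- l, 1:] * det C"
    unfolding C_def by (rule det_row_mul)
  finally have 1: "det B = [:- l, 1:] * det C" .
  have "det C = det (\<chi> r. if r = i then [:- l, 1:] *s (\<chi> k. [:u $ k:]) else C $ r)"
    using ij by (intro arg_cong[of _ _ det]) (simp add: C_def vec_eq_iff Bi)
  also have "\<dots> = [:- l, 1:] * det (\<chi> r. if r = i then (\<chi> k. [:u $ k:]) else C $ r)"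
    by (rule det_row_mul)
  finally have 2: "[:- l, 1:] dvd det C" by (rule dvdI)
  have "charpoly A * det Pc = det B"
    by (simp add: B_def det_mul charpoly_def X_def)
  then have "[:- l, 1:] ^ 2 dvd charpoly A * det Pc"
    using mult_dvd_mono[OF dvd_refl 2, of "[:- l, 1:]"] unfolding 1 power2_eq_square by (simp only:)
  moreover have nz': "charpoly A * det Pc \<noteq> 0" using nz detPc by auto
  ultimately have "2 \<le> order l (charpoly A * det Pc)" by (simp add: order_divides)
  then show ?thesis using detPc by (simp add: order_mult[OF nz'] order_0I)
qed

text \<open>
  If \<open>w\<close> and \<open>w'\<close> were different, subtracting from \<open>w'\<close> the multiple of \<open>w\<close> with the same first
  element would give a second independent eigenvector: the multiple is positive and both vectors have
  norm 1, so the difference does not vanish.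
\<close>

lemma eig_weights_unique:
  fixes F :: "real^('s::{finite,linorder})^'t" and y :: "real^'t"
  defines "p \<equiv> charpoly (transpose (err_mat y F) ** err_mat y F)"
  assumes ord: "order (Min {x. poly p x = 0}) p = 1"
    and w: "is_w_eig y F w" "first_elem w > 0"
    and w': "is_w_eig y F w'" "first_elem w' > 0"
  shows "w = w'"
proof (rule ccontr)
  assume ne: "w \<noteq> w'"
  define M where "M = err_mat y F"
  let ?G = "transpose M ** M"
  have l: "Min {x. poly p x = 0} = lambda_min ?G"
    by (simp add: lambda_min_def p_def M_def eigenvalue_iff_root)
  have eig: "?G *v x = lambda_min ?G *\<^sub>R x \<and> x \<bullet> x = 1" if x: "is_w_eig y F x" for x
  proof -
    have "is_arg_min (\<lambda>w. w \<bullet> (?G *v w) - 2 * (w \<bullet> 0)) (\<lambda>w. w \<in> W_E) x"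
      using x by (simp add: is_w_eig_def is_arg_min_def inner_gram power2_norm_eq_inner M_def)
    then obtain \<nu> where \<nu>: "?G *v x - \<nu> *\<^sub>R x = 0" "\<And>v. \<nu> * (v \<bullet> v) \<le> v \<bullet> (?G *v v)"
      using sphere_minimizer_multiplier[OF transpose_gram] by blast
    have "x \<bullet> x = 1" using x by (simp add: is_w_eig_def is_arg_min_def W_E_def)
    moreover from this have "eigenvalue ?G \<nu>"
      unfolding eigenvalue_def using \<nu>(1) by (intro exI[of _ x]) auto
    ultimately show ?thesis using lambda_min_eqI[OF transpose_gram _ \<nu>(2)] \<nu>(1) by simp
  qed
  define i where "i = Min (UNIV :: 's set)"
  define t where "t = w' $ i / w $ i"
  define v where "v = w' - t *\<^sub>R w"
  have pos: "w $ i > 0" "t > 0" using w w' by (auto simp: first_elem_def i_def t_def)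
  have "v \<noteq> 0"
  proof
    assume "v = 0"
    then have "w' = t *\<^sub>R w" by (simp add: v_def)
    moreover from this have "t * t = 1" using eig[OF w(1)] eig[OF w'(1)] by simp
    then have "t = 1" using pos by (metis abs_of_pos real_sqrt_abs2 real_sqrt_one)
    ultimately show False using ne by simp
  qed
  moreover have "?G *v v = lambda_min ?G *\<^sub>R v"
    using eig[OF w(1)] eig[OF w'(1)]
    by (simp add: v_def matrix_vector_mult_diff_distrib matrix_vector_mult_scaleR algebra_simps)
  moreover have "v $ i = 0" using pos by (simp add: v_def t_def)
  moreover have "p \<noteq> 0"
    using finite_eigenvalues[OF transpose_gram, of M] infinite_UNIV_char_0[where 'a = real]
    by (auto simp: eigenvalue_iff_root p_def M_def)
  ultimately have "order (lambda_min ?G) p \<ge> 2"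
    unfolding p_def M_def[symmetric] using order_charpoly_ge_2_if_two_eigenvectors eig[OF w(1)] pos by (metis less_irrefl)
  then show False using ord l by simp
qed

theorem proposition3:
  fixes y :: "real^'t"
    and F Fbar :: "real^('s::{finite,linorder})^'t"
    and \<psi> :: "real^('s::{finite,linorder})"
  shows
    "(lambda_min (scaled_gram F) > 0 \<longrightarrow>
        (\<forall>W \<in> {W_A, W_B, W_C, W_D}. (\<exists>!w. is_w_reg W y F w) \<and> (\<exists>!w. is_w_ma W y F \<psi> w)))
   \<and> (lambda_min (scaled_gram (add_intercept F)) > 0 \<longrightarrow>
        (\<exists>!p. is_w_reg_intercept y F p))
   \<and> (lambda_min (scaled_gram Fbar) > 0 \<longrightarrow>
        (\<forall>W \<in> {W_A, W_B, W_C, W_D}. \<exists>!w. is_w_cv W y Fbar w))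
   \<and> (resolvent_cond (transpose F ** F) (transpose F *v y)
        \<and> nondegenerate (transpose F ** F) (transpose F *v y) \<longrightarrow>
        (\<exists>!w. is_w_reg W_E y F w))
   \<and> (resolvent_cond (transpose F ** F) \<psi> \<and> nondegenerate (transpose F ** F) \<psi> \<longrightarrow>
        (\<exists>!w. is_w_ma W_E y F \<psi> w))
   \<and> (resolvent_cond (transpose Fbar ** Fbar) (transpose Fbar *v y)
        \<and> nondegenerate (transpose Fbar ** Fbar) (transpose Fbar *v y) \<longrightarrow>
        (\<exists>!w. is_w_cv W_E y Fbar w))
   \<and> (let p = charpoly (transpose (err_mat y F) ** err_mat y F) in
        order (Min {x. poly p x = 0}) p = 1
        \<and> (\<exists>w. is_w_eig y F w \<and> first_elem w > 0) \<longrightarrow>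
        (\<exists>!w. is_w_eig y F w \<and> first_elem w > 0))"
proof -
  have convex_case: "(\<exists>!w. is_w_reg W y M w) \<and> (\<exists>!w. is_w_ma W y M \<phi> w)"
    if "lambda_min (scaled_gram M) > 0" "W \<in> {W_A, W_B, W_C, W_D}"
    for M :: "real^('s::{finite,linorder})^'t" and \<phi> W
    unfolding is_w_reg_eq_ma
    using unique_ma_closed_convex[OF inj_if_lambda_min_gram_pos[OF that(1)] weight_spaces_closed_convex[OF that(2)]]
    by blast
  have sphere_case: "\<exists>!w. is_w_reg W_E y M w"
    if "resolvent_cond (transpose M ** M) (transpose M *v y)"
      "nondegenerate (transpose M ** M) (transpose M *v y)" for M :: "real^('s::{finite,linorder})^'t"
    unfolding is_w_reg_eq_ma using that
    by (intro unique_ma_sphere) (simp_all add: resolvent_cond_minus nondegenerate_def)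
  show ?thesis
    unfolding is_w_cv_eq_reg Let_def
  proof (intro conjI impI ballI)
    fix W :: "(real^('s::{finite,linorder})) set"
    assume W: "W \<in> {W_A, W_B, W_C, W_D}"
    show "\<exists>!w. is_w_reg W y F w" "\<exists>!w. is_w_ma W y F \<psi> w" if "lambda_min (scaled_gram F) > 0"
      using convex_case[OF that W] by simp_all
    show "\<exists>!w. is_w_reg W y Fbar w" if "lambda_min (scaled_gram Fbar) > 0"
      using convex_case[OF that W] by simp
  next
    assume "order (Min {x. poly (charpoly (transpose (err_mat y F) ** err_mat y F)) x = 0})
        (charpoly (transpose (err_mat y F) ** err_mat y F)) = 1
      \<and> (\<exists>w. is_w_eig y F w \<and> first_elem w > 0)"
    then show "\<exists>!w. is_w_eig y F w \<and> first_elem w > 0"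
      using eig_weights_unique by (elim conjE, intro ex_ex1I) auto
  next
    show "\<exists>!w. is_w_ma W_E y F \<psi> w"
      if "resolvent_cond (transpose F ** F) \<psi> \<and> nondegenerate (transpose F ** F) \<psi>"
      using conjunct1[OF that] conjunct2[OF that] by (rule unique_ma_sphere)
  qed (use sphere_case unique_intercept in simp_all)
qed

end
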